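(* Let $k, n$ be positive integers and suppose that $C_1, \ldots, C_n$ are sets of size $k$. Then the set of multisets $$\left\{ [c_1, \ldots, c_n] \; : \; c_j \in C_j \text{ for each } j \in \{1,\ldots,n\} \right\}$$ has size at least $\binom{k + n - 1}{n}$.
   Context: Square brackets $[c_1, \ldots, c_n]$ denote the multiset (unordered, with repetitions counted) with elements $c_1, \ldots, c_n$. The sets $C_1,\ldots,C_n$ are arbitrary finite sets of cardinality exactly $k$; they may overlap, coincide or be disjoint. *)

theory Defs
  imports Main "HOL-Library.Multiset"
begin

end

theory Submission
  imports Defs
begin

text \<open>
  The bound is Pascal's rule. Choose an index \<open>j\<close> and an element \<open>x \<in> C j\<close>. The multisets that
  contain \<open>x\<close> include all those obtained by choosing \<open>x\<close> from \<open>C j\<close> and arbitrary elements from the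
  other \<open>n - 1\<close> sets, and adding \<open>x\<close> is injective on multisets. The multisets that avoid \<open>x\<close> are
  exactly the selections from the sets \<open>C i - {x}\<close>, each of which still has at least \<open>k - 1\<close>
  elements. The two families are disjoint, so their sizes add up to at least
  \<open>(k + n - 2 choose n - 1) + (k + n - 2 choose n) = (k + n - 1 choose n)\<close>.

  The argument removes an arbitrary index and shrinks the sets by different amounts, so the
  induction runs over arbitrary finite index sets and requires \<open>card (C i) \<ge> k\<close> only.
\<close>

definition selections :: "'i set \<Rightarrow> ('i \<Rightarrow> 'a set) \<Rightarrow> 'a multiset set" where
  "selections I C = {{#c j. j \<in># mset_set I#} | c. \<forall>j\<in>I. c j \<in> C j}"

lemma selections_empty [simp]: "selections {} C = {{#}}"
  by (simp add: selections_def)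

lemma selections_insert:
  assumes "finite I" "j \<notin> I"
  shows "selections (insert j I) C = (\<Union>x\<in>C j. add_mset x ` selections I C)"
proof (intro equalityI subsetI)
  fix M assume "M \<in> selections (insert j I) C"
  then obtain c where c: "\<forall>i\<in>insert j I. c i \<in> C i" and M: "M = {#c i. i \<in># mset_set (insert j I)#}"
    by (auto simp: selections_def)
  have "M = add_mset (c j) {#c i. i \<in># mset_set I#}"
    using assms M by simp
  moreover have "{#c i. i \<in># mset_set I#} \<in> selections I C"
    using c by (auto simp: selections_def)
  ultimately show "M \<in> (\<Union>x\<in>C j. add_mset x ` selections I C)"
    using c by blast
next
  fix M assume "M \<in> (\<Union>x\<in>C j. add_mset x ` selections I C)"
  then obtain x c where x: "x \<in> C j" and c: "\<forall>i\<in>I. c i \<in> C i"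
    and M: "M = add_mset x {#c i. i \<in># mset_set I#}"
    by (auto simp: selections_def)
  have "{#c i. i \<in># mset_set I#} = {#(c(j := x)) i. i \<in># mset_set I#}"
    using assms by (intro image_mset_cong) auto
  hence "M = {#(c(j := x)) i. i \<in># mset_set (insert j I)#}"
    using assms M by simp
  moreover have "\<forall>i\<in>insert j I. (c(j := x)) i \<in> C i"
    using x c by simp
  ultimately show "M \<in> selections (insert j I) C"
    unfolding selections_def by blast
qed

lemma finite_selections:
  assumes "finite I" "\<And>i. i \<in> I \<Longrightarrow> finite (C i)"
  shows "finite (selections I C)"
  using assms by (induction I rule: finite_induct) (auto simp: selections_insert)

lemma selections_mono:
  assumes "\<And>i. i \<in> I \<Longrightarrow> C i \<subseteq> D i"
  shows "selections I C \<subseteq> selections I D"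
  using assms unfolding selections_def by blast

lemma selections_Diff_avoid:
  assumes "finite I" "M \<in> selections I (\<lambda>i. C i - {x})"
  shows "x \<notin># M"
  using assms by (auto simp: selections_def)

text \<open>
  Pascal's rule leads to \<open>(|I| - 1, k)\<close> for the selections that are forced to use \<open>x\<close> and to
  \<open>(|I|, k - 1)\<close> for those that avoid it, hence an induction on \<open>k\<close> inside one on \<open>I\<close>. It bottoms
  out at \<open>k = 0\<close>, where the binomial coefficient is 0 for nonempty \<open>I\<close>, and at \<open>I = {}\<close>, where it is 1
  even if \<open>k = 0\<close> truncates the subtraction.
\<close>

lemma card_selections_ge:
  assumes "finite I" "\<And>i. i \<in> I \<Longrightarrow> finite (C i) \<and> card (C i) \<ge> k"
  shows "card (selections I C) \<ge> (k + card I - 1) choose card I"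
  using assms
proof (induction I arbitrary: k C rule: finite_induct)
  case empty
  then show ?case by simp
next
  case (insert j I)
  from insert.prems show ?case
  proof (induction k arbitrary: C)
    case 0
    then show ?case using insert.hyps by (simp add: binomial_eq_0)
  next
    case (Suc k)
    have fin: "finite (C i)" and card: "card (C i) \<ge> Suc k" if "i \<in> insert j I" for i
      using Suc.prems that by auto
    obtain x where x: "x \<in> C j"
      using card[of j] by fastforce
    let ?A = "add_mset x ` selections I C"
    let ?B = "selections (insert j I) (\<lambda>i. C i - {x})"
    have "Suc k + card I - 1 choose card I \<le> card (selections I C)"
      using fin card by (intro insert.IH) auto
    hence A: "k + card I choose card I \<le> card ?A"
      by (simp add: card_image inj_on_def)
    have "k + card (insert j I) - 1 choose card (insert j I) \<le> card ?B"
    proof (rule Suc.IH)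
      fix i assume "i \<in> insert j I"
      thus "finite (C i - {x}) \<and> k \<le> card (C i - {x})"
        using fin[of i] card[of i] diff_card_le_card_Diff[of "{x}" "C i"] by simp
    qed
    hence B: "k + card I choose Suc (card I) \<le> card ?B"
      using insert.hyps by simp
    have fin_sel: "finite (selections (insert j I) C)"
      using insert.hyps fin by (intro finite_selections) auto
    have sub: "?A \<union> ?B \<subseteq> selections (insert j I) C"
      using x insert.hyps selections_mono[of "insert j I" "\<lambda>i. C i - {x}" C]
      by (auto simp: selections_insert)
    have disj: "?A \<inter> ?B = {}"
      using selections_Diff_avoid[of "insert j I" _ C x] insert.hyps by fastforce
    have "(Suc k + card (insert j I) - 1) choose card (insert j I)
        = (k + card I choose card I) + (k + card I choose Suc (card I))"
      using insert.hyps by simp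
    also have "\<dots> \<le> card ?A + card ?B"
      using A B by linarith
    also have "\<dots> = card (?A \<union> ?B)"
      using disj finite_subset[OF sub fin_sel] by (intro card_Un_disjoint[symmetric]) auto
    also have "\<dots> \<le> card (selections (insert j I) C)"
      by (intro card_mono fin_sel sub)
    finally show ?case .
  qed
qed

theorem theorem1p5:
  fixes k n :: nat and C :: "nat \<Rightarrow> 'a set"
  assumes "k > 0" and "n > 0"
    and "\<And>j. j \<in> {1..n} \<Longrightarrow> finite (C j) \<and> card (C j) = k"
  shows "card {{#c j. j \<in># mset_set {1..n}#} | c. \<forall>j\<in>{1..n}. c j \<in> C j} \<ge> (k + n - 1) choose n"
  using card_selections_ge[of "{1..n}" C k] assms(3) by (simp add: selections_def)

end
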